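(* For every $n\ge2$, the representations $\rho:\mathrm{IA}(F_n)\to\mathrm{GL}_n(\mathbb{Z}[t_1^{\pm1},\dots,t_n^{\pm1}])$ and $\widehat{\rho}_B: C_n\to\mathrm{GL}_n(\mathbb{Z}[t^{\pm1}])$ are not faithful.
   Context: $F_n$ is the free group with free basis $x_1,\dots,x_n$. Automorphisms act on the right, so in a product $\alpha\beta$ the automorphism $\alpha$ is applied first: $x^{\alpha\beta}=(x^\alpha)^\beta$. $\mathrm{IA}(F_n)$ is the group of automorphisms of $F_n$ acting trivially on the abelianization of $F_n$. $C_n$ is the group of conjugating automorphisms of $F_n$: automorphisms sending each $x_i$ to $f_i^{-1}x_{\pi(i)}f_i$ for some permutation $\pi$ of $\{1,\dots,n\}$ and $f_i\in F_n$. $Cb_n$ is the normal subgroup of those with $\pi=\mathrm{id}$; it is generated (McCool) by $\varepsilon_{ij}$, $1\le i\ne j\le n$, where $\varepsilon_{ij}$ maps $x_i\mapsto x_j^{-1}x_ix_j$ and $x_l\mapsto x_l$ for $l\ne i$. $C_n$ is the semidirect product of $Cb_n$ with the group $S_n$ of automorphisms permuting the basis $x_1,\dots,x_n$. Fox derivatives $\partial/\partial x_j:\mathbb{Z}F_n\to\mathbb{Z}F_n$ are the additive maps with $\partial x_i/\partial x_j=\delta_{ij}$ and $\partial(wv)/\partial x_j=(\partial w/\partial x_j)\,v^\tau+w\,\partial v/\partial x_j$, where $\tau:\mathbb{Z}F_n\to\mathbb{Z}$ is the augmentation. Let $\varphi$ be the homomorphism from $F_n$ onto the free abelian group with basis $t_1,\dots,t_n$,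 $x_i\mapsto t_i$, extended to $\mathbb{Z}F_n\to\mathbb{Z}[t_1^{\pm1},\dots,t_n^{\pm1}]$. The Magnus representation $\rho$ is $\rho(\alpha)=\left[\left(\partial(x_i^\alpha)/\partial x_j\right)^\varphi\right]_{i,j=1}^n$ for $\alpha\in\mathrm{IA}(F_n)$. Matrices act from the right on the free left module with basis $e_1,\dots,e_n$ (so $e_iM$ is the $i$-th row of $M$). $\widehat{\rho}_B$ is the representation obtained on $Cb_n$ from $\rho|_{Cb_n}$ by setting $t_1=\dots=t_n=t$, so that $\widehat{\rho}_B(\varepsilon_{ij})$ is $e_i\mapsto t^{-1}(t-1)e_j+t^{-1}e_i$, $e_l\mapsto e_l$ for $l\ne i$; and an automorphism $x_i\mapsto x_{\pi(i)}$ in $S_n$ is sent to the permutation matrix $e_i\mapsto e_{\pi(i)}$. *)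

theory Defs
  imports
    "HOL-Analysis.Determinants"
    "HOL-Algebra.Generated_Groups"
    "HOL-Library.Poly_Mapping"
begin

section \<open>Free groups\<close>

text \<open>
  The free group on a basis type \<open>'n\<close> is the quotient of the words in the letters
  \<open>x\<^sup>\<plusminus>\<^sup>1\<close>, written \<open>(x, True)\<close> and \<open>(x, False)\<close>, by free cancellation. It is written additively
  (\<open>group_add\<close> is not commutative), so that its group ring is the type
  \<open>'n free_group \<Rightarrow>\<^sub>0 int\<close> of finitely supported functions with convolution. Thus \<open>u + v\<close> is the
  product $uv$ and \<open>- u\<close> is $u^{-1}$.
\<close>

inductive cancel_step :: "('n \<times> bool) list \<Rightarrow> ('n \<times> bool) list \<Rightarrow> bool" where
  "cancel_step (u @ (x, b) # (x, \<not> b) # v) (u @ v)"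

quotient_type 'n free_group = "('n \<times> bool) list" / "equivclp (cancel_step :: ('n \<times> bool) list \<Rightarrow> _)"
  by simp

lemma equivclp_cancel_map:
  assumes "\<And>u v. cancel_step u v \<Longrightarrow> equivclp r (h u) (h v)"
    and "equivclp cancel_step u v"
  shows "equivclp r (h u) (h v)"
  using assms(2)
proof (induction rule: equivclp_induct)
  case (step y z)
  then show ?case
    by (metis assms(1) equivclp_sym equivclp_trans)
qed simp

lemma equivclp_cancel_eq:
  assumes "\<And>u v. cancel_step u v \<Longrightarrow> h u = h v" and "equivclp cancel_step u v"
  shows "h u = h v"
  using assms(2)
proof (induction rule: equivclp_induct)
  case (step y z)
  then show ?case
    by (metis assms(1))
qed simp

lemma cancel_step_append1: "cancel_step u v \<Longrightarrow> cancel_step (u @ w) (v @ w)"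
proof (induction rule: cancel_step.induct)
  case (1 u x b v)
  then show ?case using cancel_step.intros[of u x b "v @ w"] by simp
qed

lemma cancel_step_append2: "cancel_step u v \<Longrightarrow> cancel_step (w @ u) (w @ v)"
proof (induction rule: cancel_step.induct)
  case (1 u x b v)
  then show ?case using cancel_step.intros[of "w @ u" x b v] by simp
qed

definition word_inv :: "('n \<times> bool) list \<Rightarrow> ('n \<times> bool) list" where
  "word_inv w = rev (map (\<lambda>(x, b). (x, \<not> b)) w)"

lemma cancel_step_word_inv: "cancel_step u v \<Longrightarrow> cancel_step (word_inv u) (word_inv v)"
proof (induction rule: cancel_step.induct)
  case (1 u x b v)
  then show ?case using cancel_step.intros[of "word_inv v" x b "word_inv u"]
    by (simp add: word_inv_def)
qed

lemma word_inv_left: "equivclp cancel_step (word_inv w @ w) []"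
proof (induction w)
  case (Cons a w)
  obtain x b where a: "a = (x, b)" by (cases a)
  have "cancel_step (word_inv (a # w) @ (a # w)) (word_inv w @ w)"
    using cancel_step.intros[of "word_inv w" x "\<not> b" w] by (simp add: word_inv_def a)
  then show ?case using Cons by (metis equivclp_trans r_into_equivclp)
qed (simp add: word_inv_def)

instantiation free_group :: (type) group_add
begin

lift_definition zero_free_group :: "'a free_group" is "[]" .

lift_definition plus_free_group :: "'a free_group \<Rightarrow> 'a free_group \<Rightarrow> 'a free_group" is "(@)"
proof -
  fix u u' v v' :: "('a \<times> bool) list"
  assume u: "equivclp cancel_step u u'" and v: "equivclp cancel_step v v'"
  have "equivclp cancel_step (u @ v) (u' @ v)"
    by (rule equivclp_cancel_map[of _ "\<lambda>w. w @ v", OF _ u])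
      (auto intro: r_into_equivclp cancel_step_append1)
  moreover have "equivclp cancel_step (u' @ v) (u' @ v')"
    by (rule equivclp_cancel_map[of _ "\<lambda>w. u' @ w", OF _ v])
      (auto intro: r_into_equivclp cancel_step_append2)
  ultimately show "equivclp cancel_step (u @ v) (u' @ v')" by (rule equivclp_trans)
qed

lift_definition uminus_free_group :: "'a free_group \<Rightarrow> 'a free_group" is word_inv
  by (erule equivclp_cancel_map[rotated]) (auto intro: r_into_equivclp cancel_step_word_inv)

definition minus_free_group :: "'a free_group \<Rightarrow> 'a free_group \<Rightarrow> 'a free_group" where
  "minus_free_group u v = u + - v"

instance
proof
  fix a b c :: "'a free_group"
  show "a + b + c = a + (b + c)" by transfer simp
  show "0 + a = a" by transfer simp
  show "a + 0 = a" by transfer simp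
  show "- a + a = 0" by transfer (rule word_inv_left)
  show "a + - b = a - b" by (simp add: minus_free_group_def)
qed

end

lift_definition gen :: "'n \<Rightarrow> 'n free_group" is "\<lambda>x. [(x, True)]" .

lift_definition free_extend :: "('n \<Rightarrow> 'g::group_add) \<Rightarrow> 'n free_group \<Rightarrow> 'g"
  is "\<lambda>f w. sum_list (map (\<lambda>(x, b). if b then f x else - f x) w)"
  by (erule equivclp_cancel_eq[rotated])
    (auto elim!: cancel_step.cases simp: add.assoc[symmetric] simp del: add.assoc)

lemma free_extend_gen [simp]: "free_extend f (gen x) = f x"
  by transfer simp

lemma free_extend_zero [simp]: "free_extend f 0 = 0"
  by transfer simp

lemma free_extend_add [simp]: "free_extend f (u + v) = free_extend f u + free_extend f v"
  by transfer simp

lemma free_extend_minus: "free_extend f (- u) = - free_extend f u"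
  using free_extend_add[of f "- u" u] by (simp add: eq_neg_iff_add_eq_0)

lemma free_group_induct [case_names zero gen inv]:
  assumes "P 0" and "\<And>x u. P u \<Longrightarrow> P (gen x + u)" and "\<And>x u. P u \<Longrightarrow> P (- gen x + u)"
  shows "P u"
proof -
  have "P (abs_free_group w)" for w
  proof (induction w)
    case Nil
    then show ?case using assms(1) by (simp add: zero_free_group_def)
  next
    case (Cons a w)
    obtain x b where a: "a = (x, b)" by (cases a)
    have "abs_free_group (a # w) = (if b then gen x else - gen x) + abs_free_group w"
      by (auto simp: a gen.abs_eq plus_free_group.abs_eq uminus_free_group.abs_eq word_inv_def)
    then show ?case using Cons assms(2,3) by auto
  qed
  then show ?thesis by (rule free_group.abs_induct)
qed

section \<open>Automorphism groups\<close>

definition free_grp :: "'n free_group monoid" where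
  "free_grp = \<lparr>carrier = UNIV, monoid.mult = (+), one = 0\<rparr>"

text \<open>Automorphisms act on the right: in \<open>\<alpha> \<otimes> \<beta>\<close> the automorphism \<open>\<alpha>\<close> is applied first.\<close>

definition aut_grp :: "('n free_group \<Rightarrow> 'n free_group) monoid" where
  "aut_grp = \<lparr>carrier = iso free_grp free_grp, monoid.mult = (\<lambda>\<alpha> \<beta>. \<beta> \<circ> \<alpha>), one = id\<rparr>"

definition IA_grp :: "('n free_group \<Rightarrow> 'n free_group) monoid" where
  "IA_grp = aut_grp\<lparr>carrier :=
     {\<alpha> \<in> carrier aut_grp. \<forall>w.
        derived free_grp (carrier free_grp) #>\<^bsub>free_grp\<^esub> \<alpha> w =
        derived free_grp (carrier free_grp) #>\<^bsub>free_grp\<^esub> w}\<rparr>"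

definition conj_aut_grp :: "('n free_group \<Rightarrow> 'n free_group) monoid" where
  "conj_aut_grp = aut_grp\<lparr>carrier :=
     {\<alpha> \<in> carrier aut_grp. \<exists>\<pi> f. bij \<pi> \<and> (\<forall>i. \<alpha> (gen i) = - f i + gen (\<pi> i) + f i)}\<rparr>"

definition basis_conj_aut_grp :: "('n free_group \<Rightarrow> 'n free_group) monoid" where
  "basis_conj_aut_grp = aut_grp\<lparr>carrier :=
     {\<alpha> \<in> carrier aut_grp. \<exists>f. \<forall>i. \<alpha> (gen i) = - f i + gen i + f i}\<rparr>"

definition perm_aut :: "('n \<Rightarrow> 'n) \<Rightarrow> 'n free_group \<Rightarrow> 'n free_group" where
  "perm_aut \<pi> = free_extend (gen \<circ> \<pi>)"

section \<open>Fox derivatives\<close>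

definition augmentation :: "('a \<Rightarrow>\<^sub>0 int) \<Rightarrow> int" where
  "augmentation p = (\<Sum>w\<in>Poly_Mapping.keys p. Poly_Mapping.lookup p w)"

definition is_fox_derivative ::
  "'n \<Rightarrow> (('n free_group \<Rightarrow>\<^sub>0 int) \<Rightarrow> ('n free_group \<Rightarrow>\<^sub>0 int)) \<Rightarrow> bool" where
  "is_fox_derivative j D \<longleftrightarrow>
     (\<forall>p q. D (p + q) = D p + D q) \<and>
     (\<forall>i. D (frag_of (gen i)) = (if i = j then 1 else 0)) \<and>
     (\<forall>p q. D (p * q) = D p * of_int (augmentation q) + p * D q)"

definition fox_derivative ::
  "'n \<Rightarrow> ('n free_group \<Rightarrow>\<^sub>0 int) \<Rightarrow> ('n free_group \<Rightarrow>\<^sub>0 int)" where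
  "fox_derivative j = (THE D. is_fox_derivative j D)"

fun word_fox :: "'n \<Rightarrow> ('n \<times> bool) list \<Rightarrow> ('n free_group \<Rightarrow>\<^sub>0 int)" where
  "word_fox j [] = 0"
| "word_fox j ((i, b) # w) =
     (if b then (if i = j then 1 else 0) + frag_of (gen i) * word_fox j w
      else frag_of (- gen i) * (word_fox j w - (if i = j then 1 else 0)))"

lemma word_fox_append:
  "word_fox j (u @ v) = word_fox j u + frag_of (abs_free_group u) * word_fox j v"
proof (induction u)
  case Nil
  then show ?case by (simp add: zero_free_group_def[symmetric])
next
  case (Cons a u)
  obtain x b where a: "a = (x, b)" by (cases a)
  have "abs_free_group (a # u) = (if b then gen x else - gen x) + abs_free_group u"
    by (auto simp: a gen.abs_eq plus_free_group.abs_eq uminus_free_group.abs_eq word_inv_def)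
  then have "frag_of (abs_free_group (a # u)) =
      frag_of (if b then gen x else - gen x) * frag_of (abs_free_group u)"
    by (simp add: mult_single)
  then show ?case using Cons by (simp add: a algebra_simps)
qed

lift_definition group_fox :: "'n \<Rightarrow> 'n free_group \<Rightarrow> ('n free_group \<Rightarrow>\<^sub>0 int)" is word_fox
proof -
  fix j :: 'n and u v :: "('n \<times> bool) list"
  assume "equivclp cancel_step u v"
  then show "word_fox j u = word_fox j v"
  proof (rule equivclp_cancel_eq[rotated])
    fix u v :: "('n \<times> bool) list"
    assume "cancel_step u v"
    then show "word_fox j u = word_fox j v"
    proof cases
      case (1 u x b v)
      have "frag_of (gen x) * (frag_of (- gen x) * p) = p"
        "frag_of (- gen x) * (frag_of (gen x) * p) = p" for p :: "'n free_group \<Rightarrow>\<^sub>0 int"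
        by (simp_all add: mult.assoc[symmetric] mult_single)
      then show ?thesis using 1 by (simp add: word_fox_append)
    qed
  qed
qed

lemma group_fox_gen: "group_fox j (gen i) = (if i = j then 1 else 0)"
  by transfer simp

lemma group_fox_add: "group_fox j (u + v) = group_fox j u + frag_of u * group_fox j v"
  by (induction u rule: free_group.abs_induct, induction v rule: free_group.abs_induct)
    (simp add: plus_free_group.abs_eq group_fox.abs_eq word_fox_append)

lemma frag_cmul_eq: "frag_cmul c p = of_int c * (p :: 'a::monoid_add \<Rightarrow>\<^sub>0 int)"
proof (induction c rule: int_induct[where k = 0])
  case (step1 i)
  then show ?case by (simp add: frag_cmul_distrib algebra_simps)
next
  case (step2 i)
  then show ?case by (simp add: frag_cmul_diff_distrib algebra_simps)
qed simp

lemma augmentation_eq: "of_int (augmentation p) = frag_extend (\<lambda>_. (1 :: 'b::monoid_add \<Rightarrow>\<^sub>0 int)) p"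
  by (simp add: augmentation_def frag_extend_def frag_cmul_eq)

lemma augmentation_single [simp]: "augmentation (frag_of w) = 1"
  by (simp add: augmentation_def)

lemma augmentation_add: "augmentation (p + q) = augmentation p + augmentation q"
proof -
  have "(of_int (augmentation (p + q)) :: nat \<Rightarrow>\<^sub>0 int) = of_int (augmentation p + augmentation q)"
    unfolding of_int_add augmentation_eq by (rule frag_extend_add)
  then show ?thesis by (simp only: of_int_eq_iff)
qed

lemma augmentation_diff: "augmentation (p - q) = augmentation p - augmentation q"
  using augmentation_add[of "p - q" q] by simp

lemma frag_diff_induct [case_names zero one diff]:
  assumes "P 0" and "\<And>w. P (frag_of w)" and "\<And>p q. P p \<Longrightarrow> P q \<Longrightarrow> P (p - q)"
  shows "P (p :: 'a \<Rightarrow>\<^sub>0 int)"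
  by (rule frag_induction[of p UNIV]) (use assms in auto)

lemma is_fox_derivative_extend: "is_fox_derivative j (frag_extend (group_fox j))"
proof -
  let ?D = "frag_extend (group_fox j)"
  have 1: "?D (frag_of u * q) = ?D (frag_of u) * of_int (augmentation q) + frag_of u * ?D q"
    for u q
  proof (induction q rule: frag_diff_induct)
    case zero
    then show ?case by (simp add: augmentation_def)
  next
    case (one w)
    then show ?case by (simp add: mult_single group_fox_add)
  next
    case (diff p q)
    then show ?case by (simp add: frag_extend_diff augmentation_diff algebra_simps)
  qed
  have "?D (p * q) = ?D p * of_int (augmentation q) + p * ?D q" for p q
  proof (induction p rule: frag_diff_induct)
    case (one w)
    then show ?case by (rule 1)
  qed (simp_all add: frag_extend_diff algebra_simps)
  then show ?thesis
    by (simp add: is_fox_derivative_def frag_extend_add group_fox_gen)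
qed

lemma is_fox_derivative_unique:
  assumes D: "is_fox_derivative j D"
  shows "D = frag_extend (group_fox j)"
proof
  have add: "D (p + q) = D p + D q" for p q
    using D by (simp add: is_fox_derivative_def)
  have gen: "D (frag_of (gen i)) = (if i = j then 1 else 0)" for i
    using D by (simp add: is_fox_derivative_def)
  have mult: "D (frag_of (u + v)) = D (frag_of u) + frag_of u * D (frag_of v)" for u v
  proof -
    have "D (frag_of u * frag_of v) =
        D (frag_of u) * of_int (augmentation (frag_of v)) + frag_of u * D (frag_of v)"
      using D unfolding is_fox_derivative_def by blast
    then show ?thesis by (simp add: mult_single)
  qed
  have zero: "D 0 = 0" using add[of 0 0] by simp
  have one: "D (frag_of 0) = 0" using mult[of 0 0] by simp
  have inv: "D (frag_of (- gen i)) = group_fox j (- gen i)" for i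
  proof -
    have "D (frag_of (- gen i)) = - (frag_of (- gen i) * D (frag_of (gen i)))"
      using mult[of "- gen i" "gen i"] one by (simp add: eq_neg_iff_add_eq_0 del: single_one)
    moreover have "group_fox j (- gen i) = - (frag_of (- gen i) * group_fox j (gen i))"
    proof -
      have "group_fox j (- gen i + gen i) = 0" by (simp, transfer, simp)
      then show ?thesis unfolding group_fox_add by (simp add: eq_neg_iff_add_eq_0)
    qed
    ultimately show ?thesis by (simp add: gen group_fox_gen)
  qed
  have grp: "D (frag_of w) = group_fox j w" for w
  proof (induction w rule: free_group_induct)
    case zero
    have "group_fox j 0 = 0" by transfer simp
    then show ?case using one by simp
  qed (simp_all add: mult group_fox_add gen group_fox_gen inv)
  fix p
  show "D p = frag_extend (group_fox j) p"
  proof (induction p rule: frag_diff_induct)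
    case (diff p q)
    have "D (p - q) = D p - D q" using add[of "p - q" q] by (simp add: algebra_simps)
    then show ?case using diff by (simp add: frag_extend_diff)
  qed (simp_all add: zero grp)
qed

lemma fox_derivative_eq: "fox_derivative j = frag_extend (group_fox j)"
  unfolding fox_derivative_def
  using is_fox_derivative_extend is_fox_derivative_unique by (rule the_equality)

lemma is_fox_derivative_fox_derivative: "is_fox_derivative j (fox_derivative j)"
  unfolding fox_derivative_eq by (rule is_fox_derivative_extend)

section \<open>The Magnus representation\<close>

text \<open>
  The ring $\mathbb{Z}[t_i^{\pm 1}]$, with \<open>i\<close> ranging over \<open>'n\<close>, is the group ring
  \<open>int ^ 'n \<Rightarrow>\<^sub>0 int\<close> of the exponent vectors; the variable $t_i$ is \<open>frag_of (axis i 1)\<close>.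
  Likewise $\mathbb{Z}[t^{\pm 1}]$ is \<open>int \<Rightarrow>\<^sub>0 int\<close> with $t$ being \<open>frag_of 1\<close>.
\<close>

definition phi :: "('n free_group \<Rightarrow>\<^sub>0 int) \<Rightarrow> (int ^ 'n \<Rightarrow>\<^sub>0 int)" where
  "phi = frag_extend (\<lambda>w. frag_of (free_extend (\<lambda>i. axis i 1) w))"

definition magnus :: "('n free_group \<Rightarrow> 'n free_group) \<Rightarrow> (int ^ 'n \<Rightarrow>\<^sub>0 int) ^ 'n ^ 'n" where
  "magnus \<alpha> = (\<chi> i j. phi (fox_derivative j (frag_of (\<alpha> (gen i)))))"

definition set_t :: "(int ^ 'n \<Rightarrow>\<^sub>0 int) \<Rightarrow> (int \<Rightarrow>\<^sub>0 int)" where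
  "set_t = frag_extend (\<lambda>a. frag_of (\<Sum>i\<in>UNIV. a $ i))"

definition GL_grp :: "('a::semiring_1 ^ 'n ^ 'n) monoid" where
  "GL_grp = \<lparr>carrier = {M. invertible M}, monoid.mult = (**), one = mat 1\<rparr>"

section \<open>The extended Burau representation\<close>

text \<open>Matrices act from the right on row vectors, so row \<open>i\<close> of this matrix is $e_{\pi(i)}$.\<close>

definition perm_matrix :: "('n \<Rightarrow> 'n) \<Rightarrow> 'a::semiring_1 ^ 'n ^ 'n" where
  "perm_matrix \<pi> = (\<chi> i j. if j = \<pi> i then 1 else 0)"

text \<open>
  Every conjugating automorphism is uniquely \<open>\<beta> \<otimes> \<sigma>\<close> with \<open>\<beta>\<close> basis-conjugating and \<open>\<sigma>\<close> a
  permutation of the basis; the representation is prescribed on the two factors.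
\<close>

definition rho_B :: "('n free_group \<Rightarrow> 'n free_group) \<Rightarrow> (int \<Rightarrow>\<^sub>0 int) ^ 'n ^ 'n" where
  "rho_B \<alpha> = (THE M. \<exists>\<beta> \<pi>. \<beta> \<in> carrier basis_conj_aut_grp \<and> bij \<pi> \<and>
     \<alpha> = \<beta> \<otimes>\<^bsub>aut_grp\<^esub> perm_aut \<pi> \<and> M = (\<chi> i j. set_t (magnus \<beta> $ i $ j)) ** perm_matrix \<pi>)"

lemma perm_aut_comp: "perm_aut \<pi> (perm_aut \<rho> u) = perm_aut (\<pi> \<circ> \<rho>) u"
  by (induction u rule: free_group_induct)
    (simp_all add: perm_aut_def free_extend_minus)

lemma perm_aut_id: "perm_aut id u = u"
  by (induction u rule: free_group_induct) (simp_all add: perm_aut_def free_extend_minus)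

lemma perm_aut_in_aut_grp:
  assumes "bij \<pi>"
  shows "perm_aut \<pi> \<in> carrier aut_grp"
proof -
  have "perm_aut (inv_into UNIV \<pi>) (perm_aut \<pi> u) = u" "perm_aut \<pi> (perm_aut (inv_into UNIV \<pi>) u) = u" for u
    using assms unfolding perm_aut_comp
    by (simp_all add: bij_is_inj bij_is_surj surj_iff[THEN iffD1] perm_aut_id)
  then have "bij (perm_aut \<pi>)" by (metis bijI')
  then show ?thesis
    by (simp add: aut_grp_def free_grp_def iso_def hom_def perm_aut_def)
qed

lemma conj_aut_grp_decomp:
  assumes "\<alpha> \<in> carrier conj_aut_grp"
  shows "\<exists>\<beta> \<pi>. \<beta> \<in> carrier basis_conj_aut_grp \<and> bij \<pi> \<and> \<alpha> = \<beta> \<otimes>\<^bsub>aut_grp\<^esub> perm_aut \<pi>"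
proof -
  obtain \<pi> f where \<alpha>: "\<alpha> \<in> carrier aut_grp" and \<pi>: "bij \<pi>"
    and f: "\<And>i. \<alpha> (gen i) = - f i + gen (\<pi> i) + f i"
    using assms by (auto simp: conj_aut_grp_def)
  define \<sigma> where "\<sigma> = perm_aut (inv_into UNIV \<pi>)"
  have \<sigma>: "\<sigma> \<in> carrier aut_grp"
    unfolding \<sigma>_def by (rule perm_aut_in_aut_grp) (rule bij_imp_bij_inv[OF \<pi>])
  define \<beta> where "\<beta> = \<sigma> \<circ> \<alpha>"
  have "\<beta> \<in> carrier aut_grp"
    using \<alpha> \<sigma> unfolding \<beta>_def aut_grp_def
    by (auto simp: free_grp_def iso_def hom_def intro: bij_comp)
  moreover have "\<beta> (gen i) = - \<sigma> (f i) + gen i + \<sigma> (f i)" for i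
    using \<pi> by (simp add: \<beta>_def f \<sigma>_def perm_aut_def free_extend_minus bij_is_inj)
  ultimately have "\<beta> \<in> carrier basis_conj_aut_grp"
    by (auto simp: basis_conj_aut_grp_def)
  moreover have "\<alpha> = \<beta> \<otimes>\<^bsub>aut_grp\<^esub> perm_aut \<pi>"
    using \<pi> by (auto simp: aut_grp_def \<beta>_def \<sigma>_def perm_aut_comp perm_aut_id bij_is_surj surj_iff[THEN iffD1])
  ultimately show ?thesis using \<pi> by blast
qed

lemma rho_B_eq:
  fixes \<beta> :: "'n::finite free_group \<Rightarrow> 'n free_group"
  assumes \<beta>: "\<beta> \<in> carrier basis_conj_aut_grp" and \<pi>: "bij \<pi>"
  shows "rho_B (\<beta> \<otimes>\<^bsub>aut_grp\<^esub> perm_aut \<pi>) = (\<chi> i j. set_t (magnus \<beta> $ i $ j)) ** perm_matrix \<pi>"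
proof -
  have uniq: "\<gamma> = \<beta> \<and> \<rho> = \<pi>"
    if \<gamma>: "\<gamma> \<in> carrier basis_conj_aut_grp" and \<rho>: "bij \<rho>"
      and eq: "\<beta> \<otimes>\<^bsub>aut_grp\<^esub> perm_aut \<pi> = \<gamma> \<otimes>\<^bsub>aut_grp\<^esub> perm_aut \<rho>" for \<gamma> \<rho>
  proof -
    define ab :: "'n free_group \<Rightarrow> int ^ 'n" where "ab = free_extend (\<lambda>i. axis i 1)"
    have ab: "ab (perm_aut \<tau> (\<delta> (gen i))) = axis (\<tau> i) 1"
      if \<delta>: "\<delta> \<in> carrier basis_conj_aut_grp" for \<delta> \<tau> i
    proof -
      obtain g where "\<delta> (gen i) = - g + gen i + g"
        using \<delta> by (auto simp: basis_conj_aut_grp_def)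
      then show ?thesis by (simp add: ab_def perm_aut_def free_extend_minus)
    qed
    have eq': "perm_aut \<pi> (\<beta> w) = perm_aut \<rho> (\<gamma> w)" for w
      using fun_cong[OF eq, of w] by (simp add: aut_grp_def)
    have "axis (\<pi> i) (1::int) = axis (\<rho> i) 1" for i
      using ab[OF \<beta>, of \<pi> i] ab[OF \<gamma>, of \<rho> i] eq'[of "gen i"] by simp
    then have "\<rho> = \<pi>" by (metis axis_eq_axis ext zero_neq_one)
    moreover have "inj (perm_aut \<pi>)"
      using perm_aut_in_aut_grp[OF \<pi>]
      by (auto simp: aut_grp_def iso_def free_grp_def bij_betw_def)
    ultimately show ?thesis using eq' by (metis injD ext)
  qed
  show ?thesis
    unfolding rho_B_def
  proof (rule the_equality)
    show "\<exists>\<gamma> \<rho>. \<gamma> \<in> carrier basis_conj_aut_grp \<and> bij \<rho> \<and>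
        \<beta> \<otimes>\<^bsub>aut_grp\<^esub> perm_aut \<pi> = \<gamma> \<otimes>\<^bsub>aut_grp\<^esub> perm_aut \<rho> \<and>
        (\<chi> i j. set_t (magnus \<beta> $ i $ j)) ** perm_matrix \<pi> =
        (\<chi> i j. set_t (magnus \<gamma> $ i $ j)) ** perm_matrix \<rho>"
      using \<beta> \<pi> by blast
  qed (use uniq in blast)
qed

end

theory Submission
  imports Defs
begin

text \<open>
  Both maps are multiplicative by the chain rule for Fox derivatives: the coefficients
  \<open>\<partial>(x\<^sub>i\<^sup>\<alpha>)/\<partial>x\<^sub>k\<close> of the chain rule for \<open>\<alpha>\<beta>\<close> are hit by \<open>\<beta>\<close>, and this
  is invisible after \<open>\<phi>\<close> because \<open>\<beta>\<close> acts trivially on the abelianization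
  (\<open>phi_fox_chain\<close>, \<open>magnus_comp\<close>). On conjugating automorphisms the factors \<open>\<beta>\<close>
  and \<open>\<sigma>\<close> of \<open>\<beta>\<sigma>\<close> have to be moved past each other, and this is compatible with the
  matrices because the variables \<open>t\<^sub>i\<close> have become equal, so that a renaming of the basis only
  permutes the entries (\<open>set_t_phi_fox_perm\<close>).

  Neither map is injective because the inner automorphism of an element \<open>g\<close> of the second
  derived subgroup has the same image as the identity. If \<open>g\<close> has trivial image in the
  abelianization, then the Fox rules give, for \<open>x\<^sub>i \<mapsto> g\<^sup>-\<^sup>1x\<^sub>ig\<close>, the matrix entries
  \<open>\<delta>\<^sub>i\<^sub>j + (t\<^sub>i - 1)(\<partial>g/\<partial>x\<^sub>j)\<^sup>\<phi>\<close>; and on the derived subgroup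
  \<open>g \<mapsto> (\<partial>g/\<partial>x\<^sub>j)\<^sup>\<phi>\<close> is a homomorphism into an abelian group, so it vanishes
  on commutators of elements of the derived subgroup (\<open>phi_fox_commutator\<close>). It remains to
  exhibit such a \<open>g\<close> which is not central in \<open>F\<^sub>n\<close>. The symmetric group \<open>S\<^sub>4\<close> is
  generated by two elements, and its second derived subgroup is the Klein four-group, which is not
  central; an explicit \<open>g\<close> is found by lifting a double transposition
  (\<open>second_commutator_not_central\<close>).
\<close>

section \<open>Fox derivatives over the abelianization\<close>

abbreviation exponents :: "'n::finite free_group \<Rightarrow> int ^ 'n" where
  "exponents \<equiv> free_extend (\<lambda>i. axis i 1)"

abbreviation phi_fox :: "'n::finite \<Rightarrow> 'n free_group \<Rightarrow> (int ^ 'n \<Rightarrow>\<^sub>0 int)" where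
  "phi_fox j w \<equiv> phi (group_fox j w)"

lemma free_extend_diff: "free_extend f (u - v) = free_extend f u - free_extend f v"
  by (metis diff_conv_add_uminus free_extend_add free_extend_minus)

lemma frag_extend_frag_of_mult:
  fixes h :: "'a::monoid_add \<Rightarrow> 'b::monoid_add"
  assumes "\<And>u v. h (u + v) = h u + h v"
  shows "frag_extend (\<lambda>w. frag_of (h w)) (p * q) =
         frag_extend (\<lambda>w. frag_of (h w)) p * frag_extend (\<lambda>w. frag_of (h w)) q"
proof -
  let ?E = "frag_extend (\<lambda>w. frag_of (h w))"
  have "?E (frag_of u * q) = ?E (frag_of u) * ?E q" for u
  proof (induction q rule: frag_diff_induct)
    case (one w)
    then show ?case by (simp add: mult_single assms)
  qed (simp_all add: frag_extend_diff algebra_simps)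
  then show ?thesis
    by (induction p rule: frag_diff_induct) (simp_all add: frag_extend_diff algebra_simps)
qed

lemma phi_zero [simp]: "phi 0 = 0"
  by (simp add: phi_def)

lemma phi_single [simp]: "phi (frag_of w) = frag_of (exponents w)"
  by (simp add: phi_def)

lemma phi_one [simp]: "phi 1 = 1"
  using phi_single[of 0] by simp

lemma phi_add: "phi (p + q) = phi p + phi q"
  by (simp add: phi_def frag_extend_add)

lemma phi_mult: "phi (p * q) = phi p * phi q"
  unfolding phi_def by (rule frag_extend_frag_of_mult) simp

lemma phi_fox_zero [simp]: "phi_fox j 0 = 0"
  using group_fox_add[of j 0 0] by simp

lemma phi_fox_gen [simp]: "phi_fox j (gen i) = (if i = j then 1 else 0)"
  by (simp add: group_fox_gen)

lemma phi_fox_add [simp]: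
  "phi_fox j (u + v) = phi_fox j u + frag_of (exponents u) * phi_fox j v"
  by (simp add: group_fox_add phi_add phi_mult)

lemma phi_fox_minus [simp]: "phi_fox j (- u) = - (frag_of (- exponents u) * phi_fox j u)"
proof -
  have "phi_fox j (- u) + frag_of (- exponents u) * phi_fox j u = 0"
    using phi_fox_add[of j "- u" u] by (simp only: left_minus phi_fox_zero free_extend_minus)
  then show ?thesis by (simp only: eq_neg_iff_add_eq_0)
qed

lemma magnus_nth: "magnus \<alpha> $ i $ j = phi_fox j (\<alpha> (gen i))"
  by (simp add: magnus_def fox_derivative_eq)

lemma additive_minus:
  fixes \<beta> :: "'a::group_add \<Rightarrow> 'b::group_add"
  assumes "\<And>u v. \<beta> (u + v) = \<beta> u + \<beta> v"
  shows "\<beta> 0 = 0" and "\<beta> (- u) = - \<beta> u"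
proof -
  have "\<beta> 0 + \<beta> 0 = \<beta> 0 + 0" using assms[of 0 0] by simp
  then show "\<beta> 0 = 0" by (rule add_left_imp_eq)
  then show "\<beta> (- u) = - \<beta> u" using assms[of "- u" u] by (simp add: eq_neg_iff_add_eq_0)
qed

text \<open>
  An endomorphism \<open>\<beta>\<close> which is trivial on the abelianization leaves the coefficients of the
  usual chain rule unchanged under \<open>\<phi>\<close>; therefore they appear here without \<open>\<beta>\<close>.
\<close>

lemma phi_fox_chain:
  assumes add: "\<And>u v. \<beta> (u + v) = \<beta> u + \<beta> v" and ab: "\<And>w. exponents (\<beta> w) = exponents w"
  shows "phi_fox j (\<beta> u) = (\<Sum>k\<in>UNIV. phi_fox k u * phi_fox j (\<beta> (gen k)))"
proof (induction u rule: free_group_induct)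
  case zero
  then show ?case by (simp add: additive_minus[of \<beta>, OF add])
next
  case (gen x u)
  have "(\<Sum>k\<in>UNIV. phi_fox k (gen x) * phi_fox j (\<beta> (gen k))) = phi_fox j (\<beta> (gen x))"
    by (simp add: if_distrib[of "\<lambda>c. c * _"] cong: if_cong)
  then show ?case
    using gen by (simp add: add ab distrib_right sum.distrib sum_distrib_left mult.assoc
        del: phi_fox_gen)
next
  case (inv x u)
  have "(\<Sum>k\<in>UNIV. phi_fox k (- gen x) * phi_fox j (\<beta> (gen k))) = phi_fox j (\<beta> (- gen x))"
    by (simp add: additive_minus[of \<beta>, OF add] ab if_distrib[of "\<lambda>c. c * _"]
        if_distrib[of "\<lambda>c. _ * c"] if_distrib[of uminus] cong: if_cong)
  then show ?case
    using inv by (simp add: add ab free_extend_minus additive_minus[of \<beta>, OF add] distrib_right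
        sum.distrib sum_distrib_left mult.assoc del: phi_fox_gen phi_fox_minus)
qed

lemma magnus_comp:
  assumes "\<And>u v. \<beta> (u + v) = \<beta> u + \<beta> v" and "\<And>w. exponents (\<beta> w) = exponents w"
  shows "magnus (\<beta> \<circ> \<alpha>) = magnus \<alpha> ** magnus \<beta>"
  by (simp add: vec_eq_iff matrix_matrix_mult_def magnus_nth) (auto intro: phi_fox_chain assms)

lemma magnus_id: "magnus id = mat 1"
  by (simp add: vec_eq_iff mat_def magnus_nth)

section \<open>Automorphisms\<close>

lemma aut_grp_iff:
  "\<alpha> \<in> carrier aut_grp \<longleftrightarrow> bij \<alpha> \<and> (\<forall>u v. \<alpha> (u + v) = \<alpha> u + \<alpha> v)"
  by (auto simp: aut_grp_def free_grp_def iso_def hom_def)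

lemma aut_grp_add: "\<alpha> \<in> carrier aut_grp \<Longrightarrow> \<alpha> (u + v) = \<alpha> u + \<alpha> v"
  by (simp add: aut_grp_iff)

lemma aut_grp_comp:
  "\<alpha> \<in> carrier aut_grp \<Longrightarrow> \<beta> \<in> carrier aut_grp \<Longrightarrow> \<beta> \<circ> \<alpha> \<in> carrier aut_grp"
  by (auto simp: aut_grp_iff intro: bij_comp)

lemma aut_grp_mult [simp]: "\<alpha> \<otimes>\<^bsub>aut_grp\<^esub> \<beta> = \<beta> \<circ> \<alpha>"
  by (simp add: aut_grp_def)

lemma IA_grp_mult [simp]: "\<alpha> \<otimes>\<^bsub>IA_grp\<^esub> \<beta> = \<beta> \<circ> \<alpha>"
  by (simp add: IA_grp_def aut_grp_def)

lemma conj_aut_grp_mult [simp]: "\<alpha> \<otimes>\<^bsub>conj_aut_grp\<^esub> \<beta> = \<beta> \<circ> \<alpha>"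
  by (simp add: conj_aut_grp_def aut_grp_def)

lemma aut_grp_inverse:
  assumes "\<alpha> \<in> carrier aut_grp"
  obtains \<beta> where "\<beta> \<in> carrier aut_grp" "\<And>w. \<beta> (\<alpha> w) = w" "\<And>w. \<alpha> (\<beta> w) = w"
proof
  have bij: "bij \<alpha>" using assms by (simp add: aut_grp_iff)
  show left: "inv_into UNIV \<alpha> (\<alpha> w) = w" and right: "\<alpha> (inv_into UNIV \<alpha> w) = w" for w
    using bij by (simp_all add: bij_is_inj bij_is_surj surj_f_inv_f)
  have "inv_into UNIV \<alpha> (u + v) = inv_into UNIV \<alpha> u + inv_into UNIV \<alpha> v" for u v
    using aut_grp_add[OF assms, of "inv_into UNIV \<alpha> u" "inv_into UNIV \<alpha> v"] by (metis left right)
  then show "inv_into UNIV \<alpha> \<in> carrier aut_grp"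
    using bij_imp_bij_inv[OF bij] by (simp add: aut_grp_iff)
qed

lemma invertible_magnus:
  assumes \<alpha>: "\<alpha> \<in> carrier aut_grp" and ab: "\<And>w. exponents (\<alpha> w) = exponents w"
  shows "invertible (magnus \<alpha>)"
proof -
  obtain \<beta> where \<beta>: "\<beta> \<in> carrier aut_grp"
    and inv: "\<And>w. \<beta> (\<alpha> w) = w" "\<And>w. \<alpha> (\<beta> w) = w"
    using aut_grp_inverse[OF \<alpha>] by blast
  have "exponents (\<beta> w) = exponents w" for w
    using ab[of "\<beta> w"] by (simp add: inv)
  then have "magnus \<alpha> ** magnus \<beta> = magnus (\<beta> \<circ> \<alpha>)"
    using magnus_comp aut_grp_add[OF \<beta>] by metis
  moreover have "magnus \<beta> ** magnus \<alpha> = magnus (\<alpha> \<circ> \<beta>)"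
    using magnus_comp aut_grp_add[OF \<alpha>] ab by metis
  moreover have "\<beta> \<circ> \<alpha> = id" "\<alpha> \<circ> \<beta> = id"
    by (simp_all add: fun_eq_iff inv)
  ultimately show ?thesis
    unfolding invertible_def by (metis magnus_id)
qed

lemma free_grp_simps:
  "carrier free_grp = UNIV" "u \<otimes>\<^bsub>free_grp\<^esub> v = u + v" "\<one>\<^bsub>free_grp\<^esub> = 0"
  by (simp_all add: free_grp_def)

lemma group_free_grp: "group free_grp"
proof (rule groupI)
  show "\<exists>v\<in>carrier free_grp. v \<otimes>\<^bsub>free_grp\<^esub> u = \<one>\<^bsub>free_grp\<^esub>" for u :: "'a free_group"
    by (rule bexI[of _ "- u"]) (simp_all add: free_grp_def)
qed (simp_all add: free_grp_def add.assoc)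

lemma inv_free_grp [simp]: "inv\<^bsub>free_grp\<^esub> u = - u"
  by (rule group.inv_equality[OF group_free_grp]) (simp_all add: free_grp_def)

lemma subgroup_derived_free_grp: "subgroup (derived free_grp (carrier free_grp)) free_grp"
  by (simp add: group.derived_is_subgroup[OF group_free_grp])

lemma exponents_derived:
  assumes "d \<in> derived free_grp (carrier free_grp)"
  shows "exponents d = 0"
  using assms unfolding derived_def
  by (induction rule: generate.induct)
    (auto simp: free_grp_simps free_extend_minus free_extend_diff)

lemma IA_grp_aut: "\<alpha> \<in> carrier IA_grp \<Longrightarrow> \<alpha> \<in> carrier aut_grp"
  by (simp add: IA_grp_def)

lemma IA_grp_exponents:
  assumes "\<alpha> \<in> carrier IA_grp"
  shows "exponents (\<alpha> w) = exponents w"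
proof -
  let ?D = "derived free_grp (carrier free_grp)"
  have "?D #>\<^bsub>free_grp\<^esub> w = ?D #>\<^bsub>free_grp\<^esub> \<alpha> w"
    using assms by (simp add: IA_grp_def)
  then have "\<alpha> w \<in> ?D #>\<^bsub>free_grp\<^esub> w"
    by (rule group.repr_independenceD[OF group_free_grp subgroup_derived_free_grp, rotated])
      (simp add: free_grp_simps)
  then obtain d where "d \<in> ?D" "\<alpha> w = d + w"
    by (auto simp: r_coset_def free_grp_def)
  then show ?thesis by (simp add: exponents_derived)
qed

lemma magnus_hom: "magnus \<in> hom IA_grp GL_grp"
proof (rule homI)
  fix \<alpha> :: "'n::finite free_group \<Rightarrow> 'n free_group"
  assume \<alpha>: "\<alpha> \<in> carrier IA_grp"
  show "magnus \<alpha> \<in> carrier GL_grp"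
    using invertible_magnus[OF IA_grp_aut[OF \<alpha>] IA_grp_exponents[OF \<alpha>]]
    by (simp add: GL_grp_def)
  fix \<beta> :: "'n free_group \<Rightarrow> 'n free_group"
  assume \<beta>: "\<beta> \<in> carrier IA_grp"
  show "magnus (\<alpha> \<otimes>\<^bsub>IA_grp\<^esub> \<beta>) = magnus \<alpha> \<otimes>\<^bsub>GL_grp\<^esub> magnus \<beta>"
    using magnus_comp[of \<beta>, OF aut_grp_add[OF IA_grp_aut[OF \<beta>]] IA_grp_exponents[OF \<beta>]]
    by (simp add: GL_grp_def)
qed

section \<open>The extended Burau representation\<close>

lemma basis_conj_aut: "\<beta> \<in> carrier basis_conj_aut_grp \<Longrightarrow> \<beta> \<in> carrier aut_grp"
  by (simp add: basis_conj_aut_grp_def)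

lemma basis_conjE:
  assumes "\<beta> \<in> carrier basis_conj_aut_grp"
  obtains f where "\<And>i. \<beta> (gen i) = - f i + gen i + f i"
proof -
  have "\<exists>f. \<forall>i. \<beta> (gen i) = - f i + gen i + f i"
    using assms by (simp add: basis_conj_aut_grp_def)
  then show ?thesis using that by blast
qed

lemma basis_conj_exponents:
  assumes \<beta>: "\<beta> \<in> carrier basis_conj_aut_grp"
  shows "exponents (\<beta> w) = exponents w"
proof -
  obtain f where f: "\<And>i. \<beta> (gen i) = - f i + gen i + f i"
    using basis_conjE[OF \<beta>] by blast
  note add = aut_grp_add[OF basis_conj_aut[OF \<beta>]]
  have "exponents (\<beta> (gen i)) = axis i 1" for i
    by (simp add: f free_extend_minus)
  then show ?thesis
    by (induction w rule: free_group_induct)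
      (simp_all add: add additive_minus[of \<beta>, OF add] free_extend_minus)
qed

lemma basis_conj_comp:
  assumes \<beta>: "\<beta> \<in> carrier basis_conj_aut_grp" and \<gamma>: "\<gamma> \<in> carrier basis_conj_aut_grp"
  shows "\<gamma> \<circ> \<beta> \<in> carrier basis_conj_aut_grp"
proof -
  obtain f where f: "\<And>i. \<beta> (gen i) = - f i + gen i + f i"
    using basis_conjE[OF \<beta>] by blast
  obtain g where g: "\<And>i. \<gamma> (gen i) = - g i + gen i + g i"
    using basis_conjE[OF \<gamma>] by blast
  note add = aut_grp_add[OF basis_conj_aut[OF \<gamma>]]
  have "(\<gamma> \<circ> \<beta>) (gen i) = - (g i + \<gamma> (f i)) + gen i + (g i + \<gamma> (f i))" for i
    by (simp add: f g add additive_minus[of \<gamma>, OF add] minus_add add.assoc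
        del: add_uminus_conv_diff)
  then show ?thesis
    using aut_grp_comp[OF basis_conj_aut[OF \<beta>] basis_conj_aut[OF \<gamma>]]
    by (auto simp: basis_conj_aut_grp_def intro!: exI[of _ "\<lambda>i. g i + \<gamma> (f i)"])
qed

lemma perm_aut_gen [simp]: "perm_aut \<pi> (gen i) = gen (\<pi> i)"
  by (simp add: perm_aut_def)

lemma perm_aut_add [simp]: "perm_aut \<pi> (u + v) = perm_aut \<pi> u + perm_aut \<pi> v"
  by (simp add: perm_aut_def)

lemma perm_aut_minus [simp]: "perm_aut \<pi> (- u) = - perm_aut \<pi> u"
  by (simp add: perm_aut_def free_extend_minus)

lemma perm_aut_inv:
  assumes "bij \<pi>"
  shows "perm_aut (inv_into UNIV \<pi>) (perm_aut \<pi> w) = w" "perm_aut \<pi> (perm_aut (inv_into UNIV \<pi>) w) = w"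
  using assms unfolding perm_aut_comp
  by (simp_all add: bij_is_inj bij_is_surj surj_iff[THEN iffD1] perm_aut_id)

lemma basis_conj_conjugate_perm:
  assumes \<gamma>: "\<gamma> \<in> carrier basis_conj_aut_grp" and \<pi>: "bij \<pi>"
  shows "perm_aut (inv_into UNIV \<pi>) \<circ> \<gamma> \<circ> perm_aut \<pi> \<in> carrier basis_conj_aut_grp"
proof -
  obtain g where g: "\<And>i. \<gamma> (gen i) = - g i + gen i + g i"
    using basis_conjE[OF \<gamma>] by blast
  have "perm_aut (inv_into UNIV \<pi>) \<circ> \<gamma> \<circ> perm_aut \<pi> \<in> carrier aut_grp"
    using \<gamma> \<pi> by (intro aut_grp_comp perm_aut_in_aut_grp basis_conj_aut bij_imp_bij_inv)
  moreover have "(perm_aut (inv_into UNIV \<pi>) \<circ> \<gamma> \<circ> perm_aut \<pi>) (gen i) =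
      - perm_aut (inv_into UNIV \<pi>) (g (\<pi> i)) + gen i + perm_aut (inv_into UNIV \<pi>) (g (\<pi> i))" for i
    using \<pi> by (simp add: g bij_is_inj)
  ultimately show ?thesis
    by (auto simp: basis_conj_aut_grp_def
        intro!: exI[of _ "\<lambda>i. perm_aut (inv_into UNIV \<pi>) (g (\<pi> i))"])
qed

lemma set_t_zero [simp]: "set_t 0 = 0"
  by (simp add: set_t_def)

lemma set_t_single [simp]: "set_t (frag_of a) = frag_of (\<Sum>i\<in>UNIV. a $ i)"
  by (simp add: set_t_def)

lemma set_t_one [simp]: "set_t 1 = 1"
  using set_t_single[of 0] by simp

lemma set_t_add [simp]: "set_t (p + q) = set_t p + set_t q"
  by (simp add: set_t_def frag_extend_add)

lemma set_t_minus [simp]: "set_t (- p) = - set_t p"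
  by (simp add: set_t_def frag_extend_minus)

lemma set_t_diff [simp]: "set_t (p - q) = set_t p - set_t q"
  by (simp add: set_t_def frag_extend_diff)

lemma set_t_mult [simp]: "set_t (p * q) = set_t p * set_t q"
  unfolding set_t_def by (rule frag_extend_frag_of_mult) (simp add: sum.distrib)

lemma set_t_sum: "finite A \<Longrightarrow> set_t (\<Sum>k\<in>A. p k) = (\<Sum>k\<in>A. set_t (p k))"
  by (induction A rule: finite_induct) simp_all

definition burau :: "('n::finite free_group \<Rightarrow> 'n free_group) \<Rightarrow> (int \<Rightarrow>\<^sub>0 int) ^ 'n ^ 'n" where
  "burau \<beta> = (\<chi> i j. set_t (magnus \<beta> $ i $ j))"

lemma set_t_matrix_mult:
  "(\<chi> i j. set_t ((A ** B) $ i $ j)) = (\<chi> i j. set_t (A $ i $ j)) ** (\<chi> i j. set_t (B $ i $ j))"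
  by (simp add: vec_eq_iff matrix_matrix_mult_def set_t_sum)

lemma burau_comp:
  assumes "\<gamma> \<in> carrier basis_conj_aut_grp"
  shows "burau (\<gamma> \<circ> \<beta>) = burau \<beta> ** burau \<gamma>"
  using magnus_comp[of \<gamma>, OF aut_grp_add[OF basis_conj_aut[OF assms]] basis_conj_exponents[OF assms]]
  by (simp add: burau_def set_t_matrix_mult)

lemma burau_invertible:
  assumes "\<beta> \<in> carrier basis_conj_aut_grp"
  shows "invertible (burau \<beta>)"
proof -
  obtain B where "magnus \<beta> ** B = mat 1" "B ** magnus \<beta> = mat 1"
    using invertible_magnus[OF basis_conj_aut[OF assms] basis_conj_exponents[OF assms]]
    by (auto simp: invertible_def)
  moreover have "(\<chi> i j. set_t (mat 1 $ i $ j)) = (mat 1 :: _ ^ 'a ^ 'a)"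
    by (simp add: vec_eq_iff mat_def)
  ultimately show ?thesis
    unfolding burau_def invertible_def using set_t_matrix_mult by metis
qed

lemma set_t_axis: "set_t (frag_of (axis i 1)) = frag_of 1" "set_t (frag_of (- axis i 1)) = frag_of (- 1)"
  by (simp_all add: axis_def sum_negf)

text \<open>
  Before all \<open>t\<^sub>i\<close> are identified, the two sides would differ by the renaming
  \<open>t\<^sub>i \<mapsto> t\<^bsub>\<pi>(i)\<^esub>\<close> of the variables; this is why \<open>S\<^sub>n\<close> can be represented by
  permutation matrices only after the identification.
\<close>

lemma set_t_phi_fox_perm:
  assumes "inj \<pi>"
  shows "set_t (phi_fox (\<pi> j) (perm_aut \<pi> u)) = set_t (phi_fox j u)"
proof (induction u rule: free_group_induct)
  case zero
  then show ?case by (simp add: perm_aut_def)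
qed (use assms in \<open>simp_all add: inj_eq free_extend_minus set_t_axis del: set_t_single\<close>)

lemma burau_conjugate_perm:
  assumes "bij \<pi>"
  shows "burau (perm_aut (inv_into UNIV \<pi>) \<circ> \<gamma> \<circ> perm_aut \<pi>) $ i $ j = burau \<gamma> $ \<pi> i $ \<pi> j"
  using set_t_phi_fox_perm[of \<pi> j "perm_aut (inv_into UNIV \<pi>) (\<gamma> (gen (\<pi> i)))"] assms
  by (simp add: burau_def magnus_nth perm_aut_inv bij_is_inj)

lemma perm_matrix_mult_nth:
  "(perm_matrix \<pi> ** (A :: 'a::semiring_1 ^ 'm ^ 'n::finite)) $ i $ j = A $ \<pi> i $ j"
  by (simp add: perm_matrix_def matrix_matrix_mult_def if_distrib[of "\<lambda>c. c * _"] cong: if_cong)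

lemma mult_perm_matrix_nth:
  fixes A :: "'a::semiring_1 ^ 'n::finite ^ 'm"
  assumes "inj \<pi>"
  shows "(A ** perm_matrix \<pi>) $ i $ \<pi> j = A $ i $ j"
  using assms
  by (simp add: perm_matrix_def matrix_matrix_mult_def inj_eq if_distrib[of "\<lambda>c. _ * c"]
      cong: if_cong)

lemma perm_matrix_comp: "perm_matrix \<pi> ** perm_matrix \<rho> = perm_matrix (\<rho> \<circ> \<pi>)"
  by (simp add: vec_eq_iff perm_matrix_mult_nth) (simp add: perm_matrix_def)

lemma perm_matrix_invertible:
  assumes "bij (\<pi> :: 'n::finite \<Rightarrow> 'n)"
  shows "invertible (perm_matrix \<pi> :: 'a::semiring_1 ^ 'n ^ 'n)"
proof -
  have "perm_matrix id = (mat 1 :: 'a ^ 'n ^ 'n)"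
    by (simp add: vec_eq_iff perm_matrix_def mat_def eq_commute)
  then show ?thesis
    unfolding invertible_def
    by (metis assms perm_matrix_comp bij_is_inj bij_is_surj inv_o_cancel surj_iff)
qed

lemma rho_B_comp_perm:
  assumes "\<beta> \<in> carrier basis_conj_aut_grp" and "bij \<pi>"
  shows "rho_B (perm_aut \<pi> \<circ> \<beta>) = burau \<beta> ** perm_matrix \<pi>"
  using rho_B_eq[OF assms] by (simp add: burau_def)

text \<open>
  With \<open>\<delta> = \<pi>\<gamma>\<pi>\<^sup>-\<^sup>1\<close> the product \<open>(\<beta>\<pi>)(\<gamma>\<rho>)\<close> has the
  decomposition \<open>(\<beta>\<delta>)(\<pi>\<rho>)\<close>, by which \<open>rho_B\<close> is computed; multiplicativity then
  amounts to the matrix of \<open>\<delta>\<close> being the conjugate of that of \<open>\<gamma>\<close> by the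
  permutation matrix.
\<close>

lemma rho_B_mult:
  assumes \<beta>: "\<beta> \<in> carrier basis_conj_aut_grp" and \<pi>: "bij \<pi>"
    and \<gamma>: "\<gamma> \<in> carrier basis_conj_aut_grp" and \<rho>: "bij \<rho>"
  shows "rho_B ((perm_aut \<rho> \<circ> \<gamma>) \<circ> (perm_aut \<pi> \<circ> \<beta>)) =
         rho_B (perm_aut \<pi> \<circ> \<beta>) ** rho_B (perm_aut \<rho> \<circ> \<gamma>)"
proof -
  let ?\<delta> = "perm_aut (inv_into UNIV \<pi>) \<circ> \<gamma> \<circ> perm_aut \<pi>"
  have \<delta>: "?\<delta> \<in> carrier basis_conj_aut_grp"
    by (rule basis_conj_conjugate_perm[OF \<gamma> \<pi>])
  have "(perm_aut \<rho> \<circ> \<gamma>) \<circ> (perm_aut \<pi> \<circ> \<beta>) = perm_aut (\<rho> \<circ> \<pi>) \<circ> (?\<delta> \<circ> \<beta>)"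
    by (simp add: fun_eq_iff perm_aut_comp[symmetric] perm_aut_inv[OF \<pi>])
  then have "rho_B ((perm_aut \<rho> \<circ> \<gamma>) \<circ> (perm_aut \<pi> \<circ> \<beta>)) =
      burau \<beta> ** burau ?\<delta> ** perm_matrix (\<rho> \<circ> \<pi>)"
    using rho_B_comp_perm[OF basis_conj_comp[OF \<beta> \<delta>] bij_comp[OF \<pi> \<rho>]] burau_comp[OF \<delta>]
    by metis
  moreover have "burau ?\<delta> ** perm_matrix \<pi> = perm_matrix \<pi> ** burau \<gamma>"
  proof -
    have "(burau ?\<delta> ** perm_matrix \<pi>) $ i $ \<pi> j = (perm_matrix \<pi> ** burau \<gamma>) $ i $ \<pi> j" for i j
      using \<pi> by (simp add: mult_perm_matrix_nth perm_matrix_mult_nth burau_conjugate_perm bij_is_inj)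
    then show ?thesis
      using bij_is_surj[OF \<pi>] by (metis vec_eq_iff surjD)
  qed
  ultimately show ?thesis
    unfolding rho_B_comp_perm[OF \<beta> \<pi>] rho_B_comp_perm[OF \<gamma> \<rho>] perm_matrix_comp[symmetric]
    by (metis matrix_mul_assoc)
qed

lemma rho_B_hom: "rho_B \<in> hom conj_aut_grp GL_grp"
proof (rule homI)
  fix \<alpha>\<^sub>1 :: "'n::finite free_group \<Rightarrow> 'n free_group"
  assume \<alpha>\<^sub>1: "\<alpha>\<^sub>1 \<in> carrier conj_aut_grp"
  obtain \<beta> \<pi> where 1: "\<beta> \<in> carrier basis_conj_aut_grp" "bij \<pi>" "\<alpha>\<^sub>1 = perm_aut \<pi> \<circ> \<beta>"
    using conj_aut_grp_decomp[OF \<alpha>\<^sub>1] by auto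
  show "rho_B \<alpha>\<^sub>1 \<in> carrier GL_grp"
    using 1 invertible_mult[OF burau_invertible perm_matrix_invertible]
    by (simp add: GL_grp_def rho_B_comp_perm)
  fix \<alpha>\<^sub>2 :: "'n free_group \<Rightarrow> 'n free_group"
  assume \<alpha>\<^sub>2: "\<alpha>\<^sub>2 \<in> carrier conj_aut_grp"
  obtain \<gamma> \<rho> where 2: "\<gamma> \<in> carrier basis_conj_aut_grp" "bij \<rho>" "\<alpha>\<^sub>2 = perm_aut \<rho> \<circ> \<gamma>"
    using conj_aut_grp_decomp[OF \<alpha>\<^sub>2] by auto
  show "rho_B (\<alpha>\<^sub>1 \<otimes>\<^bsub>conj_aut_grp\<^esub> \<alpha>\<^sub>2) = rho_B \<alpha>\<^sub>1 \<otimes>\<^bsub>GL_grp\<^esub> rho_B \<alpha>\<^sub>2"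
    using rho_B_mult[OF 1(1,2) 2(1,2)] by (simp add: GL_grp_def 1(3) 2(3))
qed

section \<open>Inner automorphisms by elements of the second derived subgroup\<close>

definition conjugate_by :: "'a::group_add \<Rightarrow> 'a \<Rightarrow> 'a" where
  "conjugate_by g w = - g + w + g"

definition commutator :: "'a::group_add \<Rightarrow> 'a \<Rightarrow> 'a" where
  "commutator a b = - a + - b + a + b"

lemma exponents_commutator [simp]: "exponents (commutator a b) = 0"
  by (simp add: commutator_def free_extend_minus free_extend_diff)

text \<open>
  Where the exponents vanish, the twist in the Fox product rule disappears after \<open>\<phi>\<close> and
  the derivative is additive, so the contributions of \<open>a\<close> and of \<open>b\<close> cancel.
\<close>

lemma phi_fox_commutator:
  assumes "exponents a = 0" and "exponents b = 0"
  shows "phi_fox j (commutator a b) = 0"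
  using assms by (simp add: commutator_def free_extend_minus del: add_uminus_conv_diff)

lemma conjugate_by_aut: "conjugate_by g \<in> carrier aut_grp"
proof -
  have "bij (conjugate_by g)"
    by (rule o_bij[of "conjugate_by (- g)"])
      (simp_all add: fun_eq_iff conjugate_by_def add.assoc)
  then show ?thesis
    by (simp add: aut_grp_iff conjugate_by_def add.assoc)
qed

lemma conjugate_by_basis_conj: "conjugate_by g \<in> carrier basis_conj_aut_grp"
  using conjugate_by_aut[of g] by (auto simp: basis_conj_aut_grp_def conjugate_by_def)

lemma conjugate_by_IA: "conjugate_by g \<in> carrier IA_grp"
proof -
  let ?D = "derived free_grp (carrier free_grp)"
  have "?D #>\<^bsub>free_grp\<^esub> conjugate_by g w = ?D #>\<^bsub>free_grp\<^esub> w" for w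
  proof -
    have "- g + w + - (- g) + - w \<in> derived_set free_grp (carrier free_grp)"
      by (rule UN_I[of "- g"], simp add: free_grp_simps, rule UN_I[of w])
        (simp_all add: free_grp_simps)
    then have "- g + w + g + - w \<in> ?D"
      unfolding derived_def by (simp add: generate.incl)
    moreover have "conjugate_by g w = (- g + w + g + - w) + w"
      by (simp add: conjugate_by_def add.assoc)
    ultimately have "conjugate_by g w \<in> ?D #>\<^bsub>free_grp\<^esub> w"
      unfolding r_coset_def by (force simp: free_grp_def)
    then show ?thesis
      by (rule group.repr_independence[OF group_free_grp _ _ subgroup_derived_free_grp, symmetric])
        (simp add: free_grp_simps)
  qed
  then show ?thesis using conjugate_by_aut[of g] by (simp add: IA_grp_def)
qed

lemma magnus_conjugate_by:
  assumes "exponents g = 0" and "\<And>j. phi_fox j g = 0"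
  shows "magnus (conjugate_by g) = mat 1"
proof -
  have "magnus (conjugate_by g) $ i $ j = mat 1 $ i $ j" for i j
    using assms by (simp add: magnus_nth mat_def conjugate_by_def free_extend_minus)
  then show ?thesis by (simp add: vec_eq_iff)
qed

text \<open>
  The right action of the free group given by one bijection for each generator. Families with a
  member that is not bijective are given a trivial action of that generator, which makes the
  action well defined for all families.
\<close>

lift_definition free_action :: "('n \<Rightarrow> 'a \<Rightarrow> 'a) \<Rightarrow> 'n free_group \<Rightarrow> 'a \<Rightarrow> 'a"
  is "\<lambda>F w. fold (\<lambda>(z, b). if \<not> bij (F z) then id else if b then F z else inv_into UNIV (F z)) w"
proof -
  fix F :: "'n \<Rightarrow> 'a \<Rightarrow> 'a" and u v :: "('n \<times> bool) list"
  let ?h = "fold (\<lambda>(z, b). if \<not> bij (F z) then id else if b then F z else inv_into UNIV (F z))"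
  assume "equivclp cancel_step u v"
  then show "?h u = ?h v"
  proof (rule equivclp_cancel_eq[rotated])
    fix u v :: "('n \<times> bool) list"
    assume "cancel_step u v"
    then show "?h u = ?h v"
      by cases (auto simp: fun_eq_iff bij_is_inj bij_is_surj surj_f_inv_f)
  qed
qed

lemma free_action_add [simp]: "free_action F (u + v) a = free_action F v (free_action F u a)"
  by (transfer fixing: F) simp

lemma free_action_gen [simp]: "bij (F z) \<Longrightarrow> free_action F (gen z) = F z"
  by (transfer fixing: F) simp

lemma free_action_inv [simp]: "bij (F z) \<Longrightarrow> free_action F (- gen z) = inv_into UNIV (F z)"
  by (transfer fixing: F) (simp add: word_inv_def)

text \<open>
  Let \<open>x\<close> and \<open>y\<close> act as the 4-cycle \<open>p\<close> and a transposition \<open>q\<close> of adjacent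
  points. Then \<open>[x,y]\<close> and \<open>[x\<^sup>-\<^sup>1,y]\<close> act as two 3-cycles without a common fixed
  point, and their commutator acts as a double transposition which does not commute with \<open>p\<close>.
  (The more obvious choice of \<open>[x,y\<^sup>-\<^sup>1]\<close> would fail, because \<open>q\<close> is an involution.)
\<close>

lemma second_commutator_not_central:
  fixes x y :: 'n
  assumes "x \<noteq> y"
  defines "g \<equiv> commutator (commutator (gen x) (gen y)) (commutator (- gen x) (gen y))"
  shows "conjugate_by g (gen x) \<noteq> gen x"
proof
  define p p' q :: "nat \<Rightarrow> nat" where
    "p = id(0 := 1, 1 := 2, 2 := 3, 3 := 0)" and
    "p' = id(0 := 3, 1 := 0, 2 := 1, 3 := 2)" and
    "q = id(0 := 1, 1 := 0)"
  have p: "p \<circ> p' = id" "p' \<circ> p = id" and q: "q \<circ> q = id"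
    by (auto simp: p_def p'_def q_def fun_eq_iff)
  have bij: "bij p" "bij q"
    using p q by (auto intro: o_bij)
  have inv: "inv_into UNIV p = p'" "inv_into UNIV q = q"
    using p q by (auto intro: inv_unique_comp)
  define F where "F z = (if z = x then p else if z = y then q else id)" for z
  assume "conjugate_by g (gen x) = gen x"
  then have "g + conjugate_by g (gen x) = g + gen x" by simp
  then have "gen x + g = g + gen x" by (simp add: conjugate_by_def add.assoc)
  then have "free_action F (gen x + g) 0 = free_action F (g + gen x) 0" by simp
  moreover have "free_action F (gen x) = p" "free_action F (- gen x) = p'"
    "free_action F (gen y) = q" "free_action F (- gen y) = q"
    using assms(1) bij by (simp_all add: F_def inv)
  ultimately show False
    by (simp add: g_def commutator_def minus_add del: add_uminus_conv_diff)
      (simp add: p_def p'_def q_def)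
qed

theorem mainTheorem4:
  assumes "CARD('n::finite) \<ge> 2"
  shows "(magnus :: ('n free_group \<Rightarrow> 'n free_group) \<Rightarrow> (int ^ 'n \<Rightarrow>\<^sub>0 int) ^ 'n ^ 'n)
           \<in> hom IA_grp GL_grp \<and>
         \<not> inj_on (magnus :: ('n free_group \<Rightarrow> 'n free_group) \<Rightarrow> (int ^ 'n \<Rightarrow>\<^sub>0 int) ^ 'n ^ 'n)
           (carrier IA_grp) \<and>
         (rho_B :: ('n free_group \<Rightarrow> 'n free_group) \<Rightarrow> (int \<Rightarrow>\<^sub>0 int) ^ 'n ^ 'n)
           \<in> hom conj_aut_grp GL_grp \<and>
         \<not> inj_on (rho_B :: ('n free_group \<Rightarrow> 'n free_group) \<Rightarrow> (int \<Rightarrow>\<^sub>0 int) ^ 'n ^ 'n)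
           (carrier conj_aut_grp)"
proof -
  obtain x y :: 'n where "x \<noteq> y"
    using assms
    by (metis (full_types) card_le_Suc0_iff_eq finite not_less_eq_eq numeral_2_eq_2)
  define g :: "'n free_group" where
    "g = commutator (commutator (gen x) (gen y)) (commutator (- gen x) (gen y))"
  have ne: "conjugate_by g \<noteq> conjugate_by 0"
    using second_commutator_not_central[OF \<open>x \<noteq> y\<close>] unfolding g_def
    by (metis add.left_neutral add.right_neutral conjugate_by_def minus_zero)
  have magnus: "magnus (conjugate_by g) = magnus (conjugate_by 0)"
    using magnus_conjugate_by[of g] magnus_conjugate_by[of "0 :: 'n free_group"]
    by (simp add: g_def phi_fox_commutator)
  have rho_B: "rho_B (conjugate_by h) = burau (conjugate_by h) ** perm_matrix id" for h :: "'n free_group"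
  proof -
    have "perm_aut id \<circ> conjugate_by h = conjugate_by h"
      by (simp add: fun_eq_iff perm_aut_id)
    then show ?thesis
      using rho_B_comp_perm[OF conjugate_by_basis_conj[of h] bij_id] by simp
  qed
  then have "rho_B (conjugate_by g) = rho_B (conjugate_by 0)"
    by (simp add: magnus burau_def)
  moreover have "conjugate_by h \<in> carrier conj_aut_grp" for h :: "'n free_group"
    using conjugate_by_aut[of h]
    by (auto simp: conj_aut_grp_def conjugate_by_def intro!: exI[of _ id] exI[of _ "\<lambda>_. h"])
  ultimately show ?thesis
    using ne magnus conjugate_by_IA magnus_hom rho_B_hom unfolding inj_on_def by blast
qed

end
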